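(* Let $n\in\mathbb{N}$, $\mathcal{N}=\{1,\dots,n\}$, let $d_1,\dots,d_n\in\mathbb{R}^2$ be displacement vectors, let $C_i,\lambda_i>0$ ($i\in\mathcal{N}$), $L\in\mathbb{N}$, $\mu>0$, and let $(t_k)_{k\in\mathbb{N}_0}\subset\mathbb{R}_{\ge0}$ satisfy $\check T\le t_{k+1}-t_k\le\hat T$ for all $k\in\mathbb{N}_0$, where $0<\check T\le\hat T<\infty$. Let $H_k=[h_{ij,k}]\in\mathbb{R}^{n\times n}$ be the normalized channel matrices (defined in the context), satisfying $$\tau_1(H_{k+L-1}\cdots H_k)\le1-\mu\qquad\text{for all }k\in\mathbb{N}_0 .$$ Let $\sigma_{i,k}\in(0,1]$ for $i\in\mathcal{N}$, $k\in\mathbb{N}_0$, and set $\check\sigma=\inf_{i,k}\sigma_{i,k}$ and $\beta_i=C_ie^{-\lambda_i\check T}$. Let the agent positions $p_i(t)\in\mathbb{R}^2$ and references $r_i(t)\in\mathbb{R}^2$, $i\in\mathcal{N}$, evolve according to the jump-flow system: for all $i\in\mathcal{N}$, $k\in\mathbb{N}_0$, $$r_{i,k^+}=d_i+\sum_{j=1}^nh_{ij,k}\,(p_j(t_k)-d_j),\qquad p_{i,k^+}=p_i(t_k),\qquad r_i(t)=r_{i,k^+}\ \text{ for } t\in(t_k,t_{k+1}],$$ and, with the segment point $s_{i,k^+}=(1-\sigma_{i,k})\,p_i(t_k)+\sigma_{i,k}\,r_{i,k^+}$, $$\|p_i(t)-s_{i,k^+}\|\le C_ie^{-\lambda_i(t-t_k)}\|p_i(t_k)-s_{i,k^+}\|\qquad\text{for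 all }t\in(t_k,t_{k+1}],$$ so that in particular $\|p_i(t_{k+1})-s_{i,k^+}\|\le\beta_i\|p_i(t_k)-s_{i,k^+}\|$. If for all $i\in\mathcal{N}$ and all $k\in\mathbb{N}_0$ $$\sigma_{i,k}\,\beta_i<\frac12\Big((1+\check\sigma^L\mu)^{1/L}-1\Big),$$ then the desired formation is achieved asymptotically: there exists a function $c:\mathbb{R}_{\ge0}\to\mathbb{R}^2$ such that $$\lim_{t\to\infty}\|p_i(t)-c(t)-d_i\|=0\qquad\text{for all } i\in\mathcal{N}.$$
   Context: $\|\cdot\|$ is the Euclidean norm. A square matrix $A\in\mathbb{R}^{n\times n}$ is row-stochastic if it is entrywise nonnegative and each row sums to $1$; its coefficient of ergodicity is $\tau_1(A)=\frac12\max_{i,j}\sum_{s=1}^n|A_{is}-A_{js}|$. Agents: agent $i$ has dynamics $\dot x_i=f_i(t,x_i,u_i)$ with position output $p_i=g_i(t,x_i)\in\mathbb{R}^2$. The only assumption on the (possibly heterogeneous) agents is exponential convergence to a point on the segment from the current position to the reference: there exist $C_i,\lambda_i>0$ and $\sigma_i\in(0,1]$ (allowed to depend on the interval $k$, written $\sigma_{i,k}$) such that for any constant reference $r_i\in\mathbb{R}^2$ and initial time $\tau\ge0$, with $s_i(\tau)=(1-\sigma_i)p_i(\tau)+\sigma_ir_i$, there is an input $u_i$ for which $\|p_i(t)-s_i(\tau)\|\le C_ie^{-\lambda_i(t-\tau)}\|p_i(\tau)-s_i(\tau)\|$ for all $t\ge\tau$. On each interval $(t_k,t_{k+1}]$ agent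 $i$ applies such an input with $\tau=t_k$ and reference $r_{i,k^+}$, which gives the flow inequality in the claim. The subscript $k^+$ denotes a value immediately after the update at $t_k$. Normalized channel matrices: at each $t_k$ agent $i$ has a neighbor set $\mathcal{N}_{i,k}\subseteq\mathcal{N}$ with $i\in\mathcal{N}_{i,k}$ and (unknown) channel coefficients $\xi_{ij,k}\in(0,1]$ for $j\in\mathcal{N}_{i,k}$. One sets $h_{ij,k}=\xi_{ij,k}/\sum_{l\in\mathcal{N}_{i,k}}\xi_{il,k}$ if $j\in\mathcal{N}_{i,k}$ and $h_{ij,k}=0$ otherwise; hence each $H_k$ is row-stochastic. *)

theory Defs
  imports "HOL-Analysis.Analysis"
begin

definition normalized_channel_matrix ::
  "('n \<Rightarrow> 'n set) \<Rightarrow> ('n \<Rightarrow> 'n \<Rightarrow> real) \<Rightarrow> real ^ 'n ^ 'n::finite"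
  where "normalized_channel_matrix N \<xi> =
    (\<chi> i j. if j \<in> N i then \<xi> i j / (\<Sum>l\<in>N i. \<xi> i l) else 0)"

definition ergodicity_coeff :: "real ^ 'n ^ 'n::finite \<Rightarrow> real"
  where "ergodicity_coeff A =
    1 / 2 * Max (range (\<lambda>(i, j). \<Sum>s\<in>UNIV. \<bar>A $ i $ s - A $ j $ s\<bar>))"

(* backward_prod H k m is H (k + m - 1) ** ... ** H (k + 1) ** H k, later factors on the left. *)
primrec backward_prod :: "(nat \<Rightarrow> real ^ 'n ^ 'n::finite) \<Rightarrow> nat \<Rightarrow> nat \<Rightarrow> real ^ 'n ^ 'n"
  where
    "backward_prod H k 0 = mat 1"
  | "backward_prod H k (Suc m) = H (k + m) ** backward_prod H k m"

end

theory Submission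
  imports Defs
begin

text \<open>
  Put \<open>q k i = p i (t k) - d i\<close> and let \<open>V k\<close> be the diameter of the points \<open>q k i\<close>. One sampling step is
  averaging by the matrix \<open>I - \<Sigma> + \<Sigma> H\<close>, where \<open>\<Sigma>\<close> is the diagonal matrix of the \<open>\<sigma> i k\<close>, plus an error
  of norm at most \<open>\<beta> i * \<sigma> i k * V k\<close>. The averaging matrix dominates \<open>\<sigma>_inf\<close> times \<open>H\<close> entrywise, so over
  \<open>L\<close> steps averaging alone shrinks the diameter by the factor \<open>1 - \<rho>\<close> with \<open>\<rho> = \<sigma>_inf ^ L * \<mu>\<close>. The errors
  contribute at most \<open>(1 + 2 * g) ^ L - 1 = \<rho>\<close>, where \<open>g\<close> is the small gain bound.

  The supremum of \<open>\<sigma> i k * \<beta> i\<close> over \<open>k\<close> may equal \<open>g\<close>, so the strict inequalities give no uniform margin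
  directly. But \<open>\<beta> i * \<sigma>_inf < g\<close>, so there is a uniform \<open>\<epsilon>\<close> such that for every agent at every
  time either \<open>\<sigma> i k \<ge> \<sigma>_inf + \<epsilon>\<close> or \<open>\<beta> i * \<sigma> i k \<le> g - \<epsilon>\<close>. For a pair of agents at the last of \<open>L\<close>
  steps, either both satisfy the first alternative and the averaging is stronger than estimated, or one satisfies
  the second and the error is smaller. In both cases \<open>V (k + L) \<le> \<theta> * V k\<close> with \<open>\<theta> < 1\<close> independent of \<open>k\<close>.
\<close>

section \<open>Averaging by row-stochastic matrices\<close>

definition row_stochastic :: "real ^ 'n ^ 'm \<Rightarrow> bool"
  where "row_stochastic A \<longleftrightarrow> (\<forall>i j. 0 \<le> A $ i $ j) \<and> (\<forall>i. (\<Sum>j\<in>UNIV. A $ i $ j) = 1)"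

text \<open>The weights are scalars and the averaged family is vector-valued, so that one matrix
  averages positions in any real vector space.\<close>

definition average :: "real ^ 'n ^ 'm \<Rightarrow> ('n \<Rightarrow> 'a) \<Rightarrow> 'm \<Rightarrow> 'a::real_vector"
  where "average A x i = (\<Sum>j\<in>UNIV. A $ i $ j *\<^sub>R x j)"

lemma average_mat_1: "average (mat 1) x i = x i"
  unfolding average_def mat_def
  by (simp add: if_distrib[of "\<lambda>c. c *\<^sub>R _"] cong: if_cong)

lemma average_mult: "average (A ** B) x i = average A (average B x) i"
proof -
  have "average (A ** B) x i = (\<Sum>j\<in>UNIV. \<Sum>l\<in>UNIV. (A $ i $ l * B $ l $ j) *\<^sub>R x j)"
    by (simp add: average_def matrix_matrix_mult_def scaleR_left.sum)
  also have "\<dots> = (\<Sum>l\<in>UNIV. \<Sum>j\<in>UNIV. (A $ i $ l * B $ l $ j) *\<^sub>R x j)"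
    by (rule sum.swap)
  also have "\<dots> = average A (average B x) i"
    by (simp add: average_def scaleR_sum_right)
  finally show ?thesis .
qed

lemma average_add: "average A (\<lambda>l. x l + y l) i = average A x i + average A y i"
  by (simp add: average_def scaleR_add_right sum.distrib)

lemma average_scaleR: "average A (\<lambda>l. c *\<^sub>R x l) i = c *\<^sub>R average A x i"
  by (simp add: average_def scaleR_sum_right mult.commute)

lemma average_in_convex:
  assumes "row_stochastic A" "convex K" "\<And>j. x j \<in> K"
  shows "average A x i \<in> K"
  unfolding average_def
  by (rule convex_sum) (use assms in \<open>auto simp: row_stochastic_def\<close>)

lemma norm_average_le:
  fixes x :: "'n::finite \<Rightarrow> 'a::real_normed_vector"
  assumes "row_stochastic A" "\<And>j. norm (x j) \<le> b"
  shows "norm (average A x i) \<le> b"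
  using average_in_convex[OF assms(1) convex_cball[of "0::'a" b]] assms(2) by simp

lemma row_stochastic_mat_1: "row_stochastic (mat 1)"
  by (simp add: row_stochastic_def mat_def)

lemma row_stochastic_mult:
  assumes A: "row_stochastic A" and B: "row_stochastic B"
  shows "row_stochastic (A ** B)"
  unfolding row_stochastic_def
proof (intro conjI allI)
  fix i j
  show "0 \<le> (A ** B) $ i $ j"
    using A B by (auto simp: row_stochastic_def matrix_matrix_mult_def intro!: sum_nonneg)
  \<comment> \<open>A row sum is the average of the constant family 1, which makes
    \<open>average_mult\<close> applicable.\<close>
  have "(\<Sum>j\<in>UNIV. (A ** B) $ i $ j) = average (A ** B) (\<lambda>_. 1) i"
    by (simp add: average_def)
  also have "\<dots> = 1"
    using A B by (simp add: average_mult) (simp add: average_def row_stochastic_def)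
  finally show "(\<Sum>j\<in>UNIV. (A ** B) $ i $ j) = 1" .
qed

lemma row_stochastic_backward_prod:
  assumes "\<And>k. row_stochastic (H k)"
  shows "row_stochastic (backward_prod H k m)"
  by (induction m) (use assms in \<open>auto intro: row_stochastic_mult row_stochastic_mat_1\<close>)

lemma row_stochastic_normalized_channel_matrix:
  fixes N :: "'n::finite \<Rightarrow> 'n set"
  assumes ne: "\<And>i. N i \<noteq> {}" and pos: "\<And>i j. j \<in> N i \<Longrightarrow> 0 < \<xi> i j"
  shows "row_stochastic (normalized_channel_matrix N \<xi>)"
  unfolding row_stochastic_def
proof (intro conjI allI)
  fix i j
  have s: "0 < (\<Sum>l\<in>N i. \<xi> i l)"
    using ne pos by (intro sum_pos) auto
  show "0 \<le> normalized_channel_matrix N \<xi> $ i $ j"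
    using s pos[of j i] by (auto simp: normalized_channel_matrix_def)
  have "(\<Sum>j\<in>UNIV. normalized_channel_matrix N \<xi> $ i $ j) = (\<Sum>j\<in>N i. \<xi> i j / (\<Sum>l\<in>N i. \<xi> i l))"
    by (simp add: normalized_channel_matrix_def sum.If_cases)
  also have "\<dots> = 1"
    using s by (simp flip: sum_divide_distrib)
  finally show "(\<Sum>j\<in>UNIV. normalized_channel_matrix N \<xi> $ i $ j) = 1" .
qed

section \<open>The coefficient of ergodicity as a contraction factor for diameters\<close>

lemma ergodicity_coeff_ge:
  "(\<Sum>s\<in>UNIV. \<bar>A $ i $ s - A $ j $ s\<bar>) / 2 \<le> ergodicity_coeff A"
proof -
  have "(\<Sum>s\<in>UNIV. \<bar>A $ i $ s - A $ j $ s\<bar>) \<le> Max (range (\<lambda>(i, j). \<Sum>s\<in>UNIV. \<bar>A $ i $ s - A $ j $ s\<bar>))"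
    by (rule Max_ge) (auto intro: image_eqI[of _ _ "(i, j)"])
  then show ?thesis
    by (simp add: ergodicity_coeff_def)
qed

text \<open>Splitting \<open>w\<close> into positive and negative parts of common mass \<open>T\<close>, the sum \<open>\<Sum>w j x j\<close> is
  \<open>1 / T\<close> times a combination of the differences \<open>x i - x j\<close> of total weight \<open>T\<^sup>2\<close>.\<close>
lemma norm_zero_sum_combination_le:
  fixes x :: "'n::finite \<Rightarrow> 'a::real_normed_vector"
  assumes w: "(\<Sum>j\<in>UNIV. w j) = 0" and D: "\<And>i j. norm (x i - x j) \<le> D"
  shows "norm (\<Sum>j\<in>UNIV. w j *\<^sub>R x j) \<le> (\<Sum>j\<in>UNIV. \<bar>w j\<bar>) / 2 * D"
proof -
  define a b where "a j = max (w j) 0" and "b j = max (- w j) 0" for j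
  define T where "T = (\<Sum>j\<in>UNIV. a j)"
  have wab: "w j = a j - b j" and abs: "\<bar>w j\<bar> = a j + b j" and nn: "0 \<le> a j" "0 \<le> b j" for j
    by (auto simp: a_def b_def)
  have Tb: "(\<Sum>j\<in>UNIV. b j) = T"
    using w by (simp add: wab sum_subtractf T_def)
  have T: "(\<Sum>j\<in>UNIV. \<bar>w j\<bar>) / 2 = T"
    using Tb by (simp add: abs sum.distrib T_def)
  have T0: "0 \<le> T" unfolding T_def by (intro sum_nonneg nn)
  \<comment> \<open>The factor \<open>T\<close> on the left avoids a division, so that the identity
    also covers \<open>T = 0\<close>.\<close>
  have "T *\<^sub>R (\<Sum>j\<in>UNIV. w j *\<^sub>R x j) = (\<Sum>i\<in>UNIV. \<Sum>j\<in>UNIV. (a i * b j) *\<^sub>R (x i - x j))"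
  proof -
    have "(\<Sum>i\<in>UNIV. \<Sum>j\<in>UNIV. (a i * b j) *\<^sub>R x i) = T *\<^sub>R (\<Sum>i\<in>UNIV. a i *\<^sub>R x i)"
      by (simp only: Tb[symmetric] scaleR_sum_right scaleR_scaleR scaleR_left.sum[symmetric]
          sum_distrib_left[symmetric] mult.commute)
    moreover have "(\<Sum>i\<in>UNIV. \<Sum>j\<in>UNIV. (a i * b j) *\<^sub>R x j) = T *\<^sub>R (\<Sum>j\<in>UNIV. b j *\<^sub>R x j)"
      by (subst sum.swap)
        (simp only: T_def scaleR_sum_right scaleR_scaleR scaleR_left.sum[symmetric] sum_distrib_right[symmetric])
    ultimately show ?thesis
      by (simp add: wab scaleR_diff_left scaleR_diff_right sum_subtractf)
  qed
  then have "T * norm (\<Sum>j\<in>UNIV. w j *\<^sub>R x j) = norm (\<Sum>i\<in>UNIV. \<Sum>j\<in>UNIV. (a i * b j) *\<^sub>R (x i - x j))"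
    using T0 by (metis abs_of_nonneg norm_scaleR)
  also have "\<dots> \<le> (\<Sum>i\<in>UNIV. \<Sum>j\<in>UNIV. (a i * b j) * D)"
    by (intro sum_norm_le order_trans[OF norm_sum] sum_mono)
      (auto simp: abs_mult nn intro!: mult_left_mono D)
  also have "\<dots> = (\<Sum>j\<in>UNIV. a j) * (\<Sum>j\<in>UNIV. b j) * D"
    by (simp only: sum_distrib_right[symmetric] sum_distrib_left[symmetric])
  also have "\<dots> = T * (T * D)"
    by (simp add: Tb flip: T_def)
  finally have *: "T * norm (\<Sum>j\<in>UNIV. w j *\<^sub>R x j) \<le> T * (T * D)" .
  show ?thesis
  proof (cases "T = 0")
    case True
    then have "w j = 0" for j
      using T by (simp add: sum_nonneg_eq_0_iff)
    then show ?thesis by simp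
  next
    case False
    then show ?thesis using * T0 T by simp
  qed
qed

text \<open>The difference of two rows sums to zero, and half of its absolute sum is at most the
  coefficient of ergodicity.\<close>

lemma norm_average_diff_le:
  fixes x :: "'n::finite \<Rightarrow> 'a::real_normed_vector"
  assumes A: "row_stochastic A" and D: "\<And>i j. norm (x i - x j) \<le> D"
  shows "norm (average A x i - average A x j) \<le> ergodicity_coeff A * D"
proof -
  have "norm (average A x i - average A x j) = norm (\<Sum>s\<in>UNIV. (A $ i $ s - A $ j $ s) *\<^sub>R x s)"
    by (simp add: average_def scaleR_diff_left sum_subtractf)
  also have "\<dots> \<le> (\<Sum>s\<in>UNIV. \<bar>A $ i $ s - A $ j $ s\<bar>) / 2 * D"
    by (rule norm_zero_sum_combination_le)
      (use A D in \<open>auto simp: sum_subtractf row_stochastic_def\<close>)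
  also have "\<dots> \<le> ergodicity_coeff A * D"
    using D[of undefined undefined] by (intro mult_right_mono ergodicity_coeff_ge) simp
  finally show ?thesis .
qed

text \<open>Closed balls are convex. The balls around points of \<open>S\<close> put
  \<open>v\<close> within \<open>D\<close> of all of \<open>S\<close>; the ball around
  \<open>v\<close> then contains \<open>u\<close>.\<close>

lemma dist_convex_hull_le:
  fixes S :: "'a::real_normed_vector set"
  assumes D: "\<And>x y. x \<in> S \<Longrightarrow> y \<in> S \<Longrightarrow> dist x y \<le> D"
    and u: "u \<in> convex hull S" and v: "v \<in> convex hull S"
  shows "dist u v \<le> D"
proof -
  have "convex hull S \<subseteq> cball x D" if "x \<in> S" for x
    by (rule hull_minimal) (use D that in auto)
  then have "S \<subseteq> cball v D"
    using v by (force simp: dist_commute)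
  then have "convex hull S \<subseteq> cball v D"
    by (rule hull_minimal) simp
  then show ?thesis
    using u by (auto simp: dist_commute)
qed

text \<open>Collects leftover convex terms into one point of \<open>K\<close> with their total
  weight. If that weight is 0, it cannot be normalized, but any point of \<open>K\<close>
  serves.\<close>

lemma convex_combine_exists:
  assumes "convex K" "u \<in> K" "v \<in> K" "0 \<le> a" "0 \<le> b"
  shows "\<exists>w\<in>K. a *\<^sub>R u + b *\<^sub>R v = (a + b) *\<^sub>R w"
proof (cases "a + b = 0")
  case True
  then have "a = 0" "b = 0" using assms by auto
  then show ?thesis using assms by auto
next
  case False
  have "(a / (a + b)) *\<^sub>R u + (b / (a + b)) *\<^sub>R v \<in> K"
    using assms False by (intro convexD) (auto simp flip: add_divide_distrib)
  then show ?thesis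
    using False by (intro bexI) (auto simp: scaleR_add_right)
qed

section \<open>Perturbed consensus iterations\<close>

text \<open>Here \<open>q k i\<close> stands for the displaced position of agent \<open>i\<close> at
  the \<open>k\<close>-th sampling time. The factor \<open>\<sigma> i k\<close> in the error of
  \<open>step\<close> is there because the segment point lies at \<open>\<sigma> i k\<close> times
  the distance to the average.\<close>

locale perturbed_consensus =
  fixes H :: "nat \<Rightarrow> real ^ 'n ^ 'n::finite"
    and q :: "nat \<Rightarrow> 'n \<Rightarrow> 'a::real_normed_vector"
    and \<sigma> :: "'n \<Rightarrow> nat \<Rightarrow> real"
    and \<beta> :: "'n \<Rightarrow> real"
    and s g :: real
  assumes stochastic: "\<And>k. row_stochastic (H k)"
    and s_nonneg: "0 \<le> s"
    and sigma_bounds: "\<And>i k. s \<le> \<sigma> i k" "\<And>i k. \<sigma> i k \<le> 1"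
    and gain_nonneg: "\<And>i. 0 \<le> \<beta> i"
    and gain_le: "\<And>i k. \<sigma> i k * \<beta> i \<le> g"
    and step: "\<And>i k. norm (q (Suc k) i - ((1 - \<sigma> i k) *\<^sub>R q k i + \<sigma> i k *\<^sub>R average (H k) (q k) i))
      \<le> \<beta> i * (\<sigma> i k * norm (q k i - average (H k) (q k) i))"
begin

section \<open>Diameter and convex hull of the sampled points\<close>

abbreviation "K k \<equiv> convex hull (range (q k))"
abbreviation "V k \<equiv> diameter (range (q k))"
abbreviation "P \<equiv> backward_prod H"

lemma q_in_K: "q k i \<in> K k"
  by (simp add: hull_inc)

lemma hull_dist_le: "u \<in> K k \<Longrightarrow> v \<in> K k \<Longrightarrow> norm (u - v) \<le> V k"
  unfolding dist_norm[symmetric]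
  by (rule dist_convex_hull_le[OF diameter_bounded_bound]) (auto intro: finite_imp_bounded)

lemma V_nonneg: "0 \<le> V k"
  by (intro diameter_ge_0 finite_imp_bounded) auto

lemma V_le: "(\<And>i j. norm (q k i - q k j) \<le> b) \<Longrightarrow> V k \<le> b"
  by (rule diameter_le) auto

lemma average_in_K: "row_stochastic A \<Longrightarrow> (\<And>j. x j \<in> K k) \<Longrightarrow> average A x i \<in> K k"
  by (intro average_in_convex convex_convex_hull)

lemma displacement_le: "norm (q k i - average (H k) (q k) i) \<le> V k"
  by (intro hull_dist_le q_in_K average_in_K stochastic)

lemma sigma_nonneg: "0 \<le> \<sigma> i k"
  using s_nonneg sigma_bounds(1) order_trans by blast

lemma s_le_1: "s \<le> 1"
  using sigma_bounds order_trans by blast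

lemma g_nonneg: "0 \<le> g"
proof -
  have "0 \<le> \<sigma> undefined 0 * \<beta> undefined"
    by (intro mult_nonneg_nonneg sigma_nonneg gain_nonneg)
  then show ?thesis using gain_le order_trans by blast
qed

lemma step_error_le:
  assumes "\<sigma> i k * \<beta> i \<le> h"
  shows "norm (q (Suc k) i - ((1 - \<sigma> i k) *\<^sub>R q k i + \<sigma> i k *\<^sub>R average (H k) (q k) i)) \<le> h * V k"
proof -
  have "\<beta> i * (\<sigma> i k * norm (q k i - average (H k) (q k) i)) \<le> (\<sigma> i k * \<beta> i) * V k"
    using displacement_le[of k i] sigma_nonneg[of i k] gain_nonneg[of i]
    by (simp add: mult_left_mono mult.assoc mult.left_commute)
  also have "\<dots> \<le> h * V k"
    by (intro mult_right_mono assms V_nonneg)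
  finally show ?thesis
    using step[of k i] by linarith
qed

text \<open>Averaged points stay in the hull, so they are at most \<open>V k\<close> apart; each of
  the two agents adds an error of at most \<open>g * V k\<close>.\<close>

lemma V_Suc_le: "V (Suc k) \<le> (1 + 2 * g) * V k"
proof (rule V_le)
  fix i j
  define a where "a i = (1 - \<sigma> i k) *\<^sub>R q k i + \<sigma> i k *\<^sub>R average (H k) (q k) i" for i
  have "a i \<in> K k" for i
    unfolding a_def
    by (intro convexD convex_convex_hull q_in_K average_in_K stochastic)
      (use sigma_bounds sigma_nonneg in auto)
  then have "norm (a i - a j) \<le> V k"
    by (intro hull_dist_le)
  moreover have "norm (q (Suc k) i - a i) \<le> g * V k" "norm (q (Suc k) j - a j) \<le> g * V k"
    unfolding a_def by (intro step_error_le gain_le)+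
  moreover have "q (Suc k) i - q (Suc k) j = (a i - a j) + (q (Suc k) i - a i) - (q (Suc k) j - a j)"
    by simp
  ultimately have "norm (q (Suc k) i - q (Suc k) j) \<le> V k + g * V k + g * V k"
    by (smt (verit) norm_triangle_ineq norm_triangle_ineq4)
  then show "norm (q (Suc k) i - q (Suc k) j) \<le> (1 + 2 * g) * V k"
    by (simp add: algebra_simps)
qed

lemma V_add_le: "V (k + m) \<le> (1 + 2 * g) ^ m * V k"
proof (induction m)
  case (Suc m)
  have "V (k + Suc m) \<le> (1 + 2 * g) * V (k + m)"
    using V_Suc_le[of "k + m"] by simp
  also have "\<dots> \<le> (1 + 2 * g) * ((1 + 2 * g) ^ m * V k)"
    using Suc g_nonneg by (intro mult_left_mono) auto
  finally show ?case by (simp add: mult.assoc)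
qed simp

text \<open>The constants \<open>s'\<close> and \<open>h\<close> for the last step are free so that either of them can be improved over \<open>s\<close> and
  \<open>g\<close>.\<close>
lemma approx_Suc:
  assumes z: "\<And>l. z l \<in> K k"
    and near: "\<And>l. norm (q (k + m) l - (c *\<^sub>R average (P k m) (q k) l + (1 - c) *\<^sub>R z l)) \<le> E"
    and c: "0 \<le> c" "c \<le> 1" and s': "0 \<le> s'" "s' \<le> \<sigma> i (k + m)" and h: "\<sigma> i (k + m) * \<beta> i \<le> h"
  shows "\<exists>w\<in>K k. norm (q (k + Suc m) i -
      ((s' * c) *\<^sub>R average (P k (Suc m)) (q k) i + (1 - s' * c) *\<^sub>R w)) \<le> E + h * V (k + m)"
proof -
  let ?H = "H (k + m)" and ?\<sigma> = "\<sigma> i (k + m)"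
  define x where "x l = c *\<^sub>R average (P k m) (q k) l + (1 - c) *\<^sub>R z l" for l
  have xK: "x l \<in> K k" for l
    unfolding x_def using c z
    by (intro convexD convex_convex_hull average_in_K row_stochastic_backward_prod stochastic q_in_K) auto
  have \<sigma>: "0 \<le> ?\<sigma>" "?\<sigma> \<le> 1" by (rule sigma_nonneg, rule sigma_bounds)
  have Hx: "average ?H x i = c *\<^sub>R average (P k (Suc m)) (q k) i + (1 - c) *\<^sub>R average ?H z i"
    by (simp add: x_def[abs_def] average_add average_scaleR average_mult)
  \<comment> \<open>First merging: the kept part and the surplus of the averaging weight over
    \<open>s'\<close> become one point of weight \<open>1 - s'\<close>.\<close>
  have "\<exists>u\<in>K k. (1 - ?\<sigma>) *\<^sub>R x i + (?\<sigma> - s') *\<^sub>R average ?H x i = ((1 - ?\<sigma>) + (?\<sigma> - s')) *\<^sub>R u"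
    using \<sigma> s' by (intro convex_combine_exists convex_convex_hull xK average_in_K stochastic) auto
  then obtain u where u: "u \<in> K k"
    "(1 - ?\<sigma>) *\<^sub>R x i + (?\<sigma> - s') *\<^sub>R average ?H x i = ((1 - ?\<sigma>) + (?\<sigma> - s')) *\<^sub>R u"
    by blast
  \<comment> \<open>Second merging: the share of \<open>z\<close> in the remaining average joins
    \<open>u\<close>, which leaves the weight \<open>s' * c\<close> on the matrix product.\<close>
  have "\<exists>w\<in>K k. (1 - s') *\<^sub>R u + (s' * (1 - c)) *\<^sub>R average ?H z i = ((1 - s') + s' * (1 - c)) *\<^sub>R w"
    using \<sigma> s' c by (intro convex_combine_exists convex_convex_hull u(1) average_in_K stochastic z) auto
  then obtain w where w: "w \<in> K k"
    "(1 - s') *\<^sub>R u + (s' * (1 - c)) *\<^sub>R average ?H z i = ((1 - s') + s' * (1 - c)) *\<^sub>R w"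
    by blast
  have "(1 - ?\<sigma>) *\<^sub>R x i + ?\<sigma> *\<^sub>R average ?H x i
      = s' *\<^sub>R average ?H x i + ((1 - ?\<sigma>) *\<^sub>R x i + (?\<sigma> - s') *\<^sub>R average ?H x i)"
    by (simp add: algebra_simps)
  also have "\<dots> = s' *\<^sub>R average ?H x i + (1 - s') *\<^sub>R u"
    by (subst u(2)) simp
  also have "\<dots> = (s' * c) *\<^sub>R average (P k (Suc m)) (q k) i
      + ((1 - s') *\<^sub>R u + (s' * (1 - c)) *\<^sub>R average ?H z i)"
    by (simp only: Hx scaleR_add_right scaleR_scaleR) simp
  also have "\<dots> = (s' * c) *\<^sub>R average (P k (Suc m)) (q k) i + (1 - s' * c) *\<^sub>R w"
    by (subst w(2)) (simp add: algebra_simps)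
  finally have split: "(1 - ?\<sigma>) *\<^sub>R x i + ?\<sigma> *\<^sub>R average ?H x i
    = (s' * c) *\<^sub>R average (P k (Suc m)) (q k) i + (1 - s' * c) *\<^sub>R w" .
  define y where "y = q (k + m)"
  have e: "norm (y l - x l) \<le> E" for l
    using near by (simp add: x_def y_def)
  have He: "norm (average ?H y i - average ?H x i) \<le> E"
  proof -
    have "average ?H y i - average ?H x i = average ?H (\<lambda>l. y l - x l) i"
      by (simp add: average_def scaleR_diff_right sum_subtractf)
    then show ?thesis using norm_average_le[OF stochastic e] by simp
  qed
  \<comment> \<open>The inherited error enters as a convex combination and is carried over without
    growth.\<close>
  have avg: "norm ((1 - ?\<sigma>) *\<^sub>R (y i - x i) + ?\<sigma> *\<^sub>R (average ?H y i - average ?H x i)) \<le> (1 - ?\<sigma>) * E + ?\<sigma> * E"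
    by (rule norm_triangle_le) (use \<sigma> e He in \<open>auto intro!: add_mono mult_left_mono\<close>)
  have pert: "norm (q (Suc (k + m)) i - ((1 - ?\<sigma>) *\<^sub>R y i + ?\<sigma> *\<^sub>R average ?H y i)) \<le> h * V (k + m)"
    unfolding y_def by (rule step_error_le[OF h])
  have "q (k + Suc m) i - ((1 - ?\<sigma>) *\<^sub>R x i + ?\<sigma> *\<^sub>R average ?H x i)
    = ((1 - ?\<sigma>) *\<^sub>R (y i - x i) + ?\<sigma> *\<^sub>R (average ?H y i - average ?H x i))
      + (q (Suc (k + m)) i - ((1 - ?\<sigma>) *\<^sub>R y i + ?\<sigma> *\<^sub>R average ?H y i))"
    by (simp add: algebra_simps)
  also have "norm \<dots> \<le> ((1 - ?\<sigma>) * E + ?\<sigma> * E) + h * V (k + m)"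
    by (rule norm_triangle_mono[OF avg pert])
  also have "\<dots> = E + h * V (k + m)"
    by (simp add: left_diff_distrib)
  finally have "norm (q (k + Suc m) i - ((1 - ?\<sigma>) *\<^sub>R x i + ?\<sigma> *\<^sub>R average ?H x i)) \<le> E + h * V (k + m)" .
  then show ?thesis
    using w(1) split by auto
qed

text \<open>Each step keeps the fraction \<open>s\<close> of the weight on the matrix product, hence
  \<open>s ^ m\<close>. The errors \<open>g * V (k + l)\<close> with \<open>l < m\<close> are
  bounded by a geometric sum: \<open>g\<close> times the sum of the \<open>(1 + 2 * g) ^ l\<close>
  is \<open>((1 + 2 * g) ^ m - 1) / 2\<close>.\<close>

lemma approx:
  "\<exists>z. (\<forall>l. z l \<in> K k) \<and> (\<forall>l. norm (q (k + m) l - (s ^ m *\<^sub>R average (P k m) (q k) l + (1 - s ^ m) *\<^sub>R z l))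
    \<le> ((1 + 2 * g) ^ m - 1) / 2 * V k)"
proof (induction m)
  case 0
  \<comment> \<open>The weight of \<open>z\<close> is \<open>1 - s ^ 0 = 0\<close>, so any family in
    the hull would do.\<close>
  show ?case by (rule exI[of _ "q k"]) (simp add: average_mat_1 q_in_K)
next
  case (Suc m)
  then obtain z where z: "\<And>l. z l \<in> K k"
    "\<And>l. norm (q (k + m) l - (s ^ m *\<^sub>R average (P k m) (q k) l + (1 - s ^ m) *\<^sub>R z l))
      \<le> ((1 + 2 * g) ^ m - 1) / 2 * V k"
    by blast
  have "\<exists>w\<in>K k. norm (q (k + Suc m) l - ((s * s ^ m) *\<^sub>R average (P k (Suc m)) (q k) l + (1 - s * s ^ m) *\<^sub>R w))
      \<le> ((1 + 2 * g) ^ m - 1) / 2 * V k + g * V (k + m)" for l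
    by (rule approx_Suc[OF z])
      (use s_nonneg s_le_1 sigma_bounds gain_le in \<open>auto simp: power_le_one\<close>)
  moreover have "((1 + 2 * g) ^ m - 1) / 2 * V k + g * V (k + m) \<le> ((1 + 2 * g) ^ Suc m - 1) / 2 * V k"
    using mult_left_mono[OF V_add_le[of k m] g_nonneg] by (simp add: algebra_simps add_divide_distrib diff_divide_distrib)
  ultimately show ?case
    unfolding power_Suc by (meson order_trans)
qed

text \<open>With \<open>c = s' * s ^ m\<close>, the parts of weight \<open>c\<close> are at most
  \<open>(1 - \<mu>) * V k\<close> apart and the rest at most \<open>V k\<close>, which gives
  \<open>1 - c * \<mu>\<close>; the errors of both agents are added. The weights must agree for the
  parts to be subtracted, so \<open>s'\<close> is common to both agents, while the gain bounds
  \<open>h\<close> and \<open>h'\<close> may differ.\<close>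

lemma pair_contraction:
  assumes erg: "ergodicity_coeff (P k (Suc m)) \<le> 1 - \<mu>"
    and s': "0 \<le> s'" "s' \<le> \<sigma> i (k + m)" "s' \<le> \<sigma> j (k + m)"
    and h: "\<sigma> i (k + m) * \<beta> i \<le> h" "\<sigma> j (k + m) * \<beta> j \<le> h'"
  shows "norm (q (k + Suc m) i - q (k + Suc m) j)
    \<le> ((1 + 2 * g) ^ m * (1 + (h + h')) - s' * s ^ m * \<mu>) * V k"
proof -
  let ?E = "((1 + 2 * g) ^ m - 1) / 2 * V k" and ?A = "average (P k (Suc m)) (q k)"
  define c where "c = s' * s ^ m"
  obtain z where z: "\<And>l. z l \<in> K k"
    "\<And>l. norm (q (k + m) l - (s ^ m *\<^sub>R average (P k m) (q k) l + (1 - s ^ m) *\<^sub>R z l)) \<le> ?E"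
    using approx[of k m] by blast
  have sm: "0 \<le> s ^ m" "s ^ m \<le> 1"
    using s_nonneg s_le_1 by (auto simp: power_le_one)
  obtain v where v: "v \<in> K k"
    "norm (q (k + Suc m) i - (c *\<^sub>R ?A i + (1 - c) *\<^sub>R v)) \<le> ?E + h * V (k + m)"
    using approx_Suc[OF z sm s'(1,2) h(1)] unfolding c_def by blast
  obtain w where w: "w \<in> K k"
    "norm (q (k + Suc m) j - (c *\<^sub>R ?A j + (1 - c) *\<^sub>R w)) \<le> ?E + h' * V (k + m)"
    using approx_Suc[OF z sm s'(1,3) h(2)] unfolding c_def by blast
  have "s' \<le> 1" using s'(2) sigma_bounds(2) order_trans by blast
  then have c: "0 \<le> c" "c \<le> 1"
    using s'(1) sm by (auto simp: c_def mult_le_one)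
  have hn: "0 \<le> h + h'"
    using h sigma_nonneg gain_nonneg by (smt (verit) mult_nonneg_nonneg)
  have "norm (?A i - ?A j) \<le> ergodicity_coeff (P k (Suc m)) * V k"
    by (intro norm_average_diff_le row_stochastic_backward_prod stochastic hull_dist_le q_in_K)
  also have "\<dots> \<le> (1 - \<mu>) * V k"
    by (intro mult_right_mono erg V_nonneg)
  finally have "c * norm (?A i - ?A j) + (1 - c) * norm (v - w) \<le> c * ((1 - \<mu>) * V k) + (1 - c) * V k"
    using c v w by (intro add_mono mult_left_mono hull_dist_le) auto
  then have "norm (c *\<^sub>R (?A i - ?A j) + (1 - c) *\<^sub>R (v - w)) \<le> c * ((1 - \<mu>) * V k) + (1 - c) * V k"
    using c by (intro norm_triangle_le) simp
  moreover have "q (k + Suc m) i - q (k + Suc m) j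
    = (c *\<^sub>R (?A i - ?A j) + (1 - c) *\<^sub>R (v - w)) + (q (k + Suc m) i - (c *\<^sub>R ?A i + (1 - c) *\<^sub>R v))
      - (q (k + Suc m) j - (c *\<^sub>R ?A j + (1 - c) *\<^sub>R w))"
    by (simp add: algebra_simps)
  ultimately have "norm (q (k + Suc m) i - q (k + Suc m) j)
    \<le> (c * ((1 - \<mu>) * V k) + (1 - c) * V k) + (?E + h * V (k + m)) + (?E + h' * V (k + m))"
    using v(2) w(2) by (smt (verit) norm_triangle_ineq norm_triangle_ineq4)
  also have "\<dots> = (c * ((1 - \<mu>) * V k) + (1 - c) * V k) + ((1 + 2 * g) ^ m - 1) * V k + (h + h') * V (k + m)"
    by (simp add: field_simps)
  also have "\<dots> \<le> (c * ((1 - \<mu>) * V k) + (1 - c) * V k) + ((1 + 2 * g) ^ m - 1) * V k + (h + h') * ((1 + 2 * g) ^ m * V k)"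
    by (intro add_left_mono mult_left_mono V_add_le hn)
  also have "\<dots> = ((1 + 2 * g) ^ m * (1 + (h + h')) - c * \<mu>) * V k"
    by (simp add: algebra_simps)
  finally show ?thesis
    by (simp add: c_def)
qed

text \<open>With \<open>s' = s\<close> and both gains bounded by \<open>g\<close>,
  \<open>pair_contraction\<close> only gives a factor at most 1. For \<open>L = Suc m\<close>, using
  \<open>s + \<epsilon>\<close> lowers it by \<open>\<epsilon> * s ^ m * \<mu>\<close>; using
  \<open>g - \<epsilon>\<close> for one agent lowers it by at least \<open>\<epsilon>\<close>, since
  \<open>(1 + 2 * g) ^ m \<ge> 1\<close>.\<close>

lemma uniform_contraction:
  assumes erg: "\<And>k. ergodicity_coeff (P k L) \<le> 1 - \<mu>" and L: "L \<ge> 1"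
    and s: "0 < s" and \<mu>: "0 < \<mu>" and g: "(1 + 2 * g) ^ L \<le> 1 + s ^ L * \<mu>"
    and strict: "\<And>i. s * \<beta> i < g"
  shows "\<exists>\<theta>. 0 \<le> \<theta> \<and> \<theta> < 1 \<and> (\<forall>k. V (k + L) \<le> \<theta> * V k)"
proof -
  obtain m where m: "L = Suc m" using L by (cases L) auto
  \<comment> \<open>Solution of \<open>(s + \<delta> i) * \<beta> i = g - \<delta> i\<close>, the
    margin at which the two alternatives meet. The minimum over finitely many agents stays
    positive.\<close>
  define \<delta> where "\<delta> i = (g - s * \<beta> i) / (1 + \<beta> i)" for i
  define \<epsilon> where "\<epsilon> = Min (range \<delta>)"
  have "0 < \<delta> i" for i
    using strict[of i] gain_nonneg[of i] by (simp add: \<delta>_def)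
  then have \<epsilon>: "0 < \<epsilon>" "\<epsilon> \<le> \<delta> i" for i
    by (auto simp: \<epsilon>_def)
  have dichotomy: "\<sigma> i k * \<beta> i \<le> g - \<epsilon> \<or> s + \<epsilon> \<le> \<sigma> i k" for i k
  proof (rule disjCI)
    assume "\<not> s + \<epsilon> \<le> \<sigma> i k"
    then have "\<sigma> i k * \<beta> i \<le> (s + \<epsilon>) * \<beta> i"
      by (intro mult_right_mono gain_nonneg) auto
    moreover have "\<epsilon> * (1 + \<beta> i) \<le> g - s * \<beta> i"
      using \<epsilon>(2)[of i] gain_nonneg[of i] by (simp add: \<delta>_def pos_le_divide_eq)
    ultimately show "\<sigma> i k * \<beta> i \<le> g - \<epsilon>"
      by (simp add: algebra_simps)
  qed
  \<comment> \<open>The two inner terms belong to the two alternatives and may be negative; the 0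
    makes the factor fit for iteration.\<close>
  define \<theta> where "\<theta> = max 0 (max (1 - \<epsilon> * s ^ m * \<mu>) (1 - \<epsilon>))"
  have \<theta>: "0 \<le> \<theta>" "1 - \<epsilon> * s ^ m * \<mu> \<le> \<theta>" "1 - \<epsilon> \<le> \<theta>"
    by (auto simp: \<theta>_def)
  have lt: "\<theta> < 1"
    using \<epsilon>(1) s \<mu> by (simp add: \<theta>_def)
  have g': "(1 + 2 * g) ^ m * (1 + (g + g)) \<le> 1 + s * s ^ m * \<mu>"
    using g by (simp add: m algebra_simps)
  have small: "(1 + 2 * g) ^ m * (1 + (2 * g - \<epsilon>)) - s * s ^ m * \<mu> \<le> \<theta>"
  proof -
    have "1 * \<epsilon> \<le> (1 + 2 * g) ^ m * \<epsilon>"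
      using \<epsilon>(1) g_nonneg by (intro mult_right_mono one_le_power) auto
    then show ?thesis
      using g' \<theta>(3) by (simp add: algebra_simps)
  qed
  have "V (k + L) \<le> \<theta> * V k" for k
  proof (rule V_le)
    fix i j
    have erg': "ergodicity_coeff (P k (Suc m)) \<le> 1 - \<mu>"
      using erg m by simp
    note pair = pair_contraction[OF erg', of _ i j]
    consider "s + \<epsilon> \<le> \<sigma> i (k + m)" "s + \<epsilon> \<le> \<sigma> j (k + m)"
      | "\<sigma> i (k + m) * \<beta> i \<le> g - \<epsilon>" | "\<sigma> j (k + m) * \<beta> j \<le> g - \<epsilon>"
      using dichotomy by blast
    then have "\<exists>b\<le>\<theta>. norm (q (k + Suc m) i - q (k + Suc m) j) \<le> b * V k"
    proof cases
      case 1
      have "(1 + 2 * g) ^ m * (1 + (g + g)) - (s + \<epsilon>) * s ^ m * \<mu> \<le> \<theta>"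
        using g' \<theta>(2) by (simp add: algebra_simps)
      then show ?thesis
        using pair[OF _ 1 gain_le gain_le] s \<epsilon>(1) by (intro exI[of _ "_ - _"]) auto
    next
      case 2
      have "(1 + 2 * g) ^ m * (1 + (g - \<epsilon> + g)) - s * s ^ m * \<mu> \<le> \<theta>"
        using small by (simp add: algebra_simps)
      then show ?thesis
        using pair[OF s_nonneg sigma_bounds(1) sigma_bounds(1) 2 gain_le] by blast
    next
      case 3
      have "(1 + 2 * g) ^ m * (1 + (g + (g - \<epsilon>))) - s * s ^ m * \<mu> \<le> \<theta>"
        using small by (simp add: algebra_simps)
      then show ?thesis
        using pair[OF s_nonneg sigma_bounds(1) sigma_bounds(1) gain_le 3] by blast
    qed
    then show "norm (q (k + L) i - q (k + L) j) \<le> \<theta> * V k"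
      unfolding m by (meson V_nonneg mult_right_mono order_trans)
  qed
  then show ?thesis using \<theta>(1) lt by blast
qed

end

section \<open>Convergence in continuous time\<close>

text \<open>Going down by steps of \<open>L\<close> ends at one of the first \<open>L\<close>
  values, whose maximum is \<open>M\<close>; the number \<open>n div L\<close> of steps tends to
  infinity.\<close>

lemma tendsto_zero_if_contracting:
  fixes f :: "nat \<Rightarrow> real"
  assumes nn: "\<And>n. 0 \<le> f n" and \<theta>: "0 \<le> \<theta>" "\<theta> < 1" and L: "L \<ge> 1"
    and contr: "\<And>n. f (n + L) \<le> \<theta> * f n"
  shows "f \<longlonglongrightarrow> 0"
proof -
  define M where "M = Max (f ` {..<L})"
  have bound: "f n \<le> \<theta> ^ (n div L) * M" for n
  proof (induction n rule: less_induct)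
    case (less n)
    show ?case
    proof (cases "n < L")
      case True
      then show ?thesis by (auto simp: M_def)
    next
      case False
      then have "f n \<le> \<theta> * f (n - L)"
        using contr[of "n - L"] by simp
      also have "\<dots> \<le> \<theta> * (\<theta> ^ ((n - L) div L) * M)"
        using False L \<theta> by (intro mult_left_mono less) auto
      also have "\<dots> = \<theta> ^ (n div L) * M"
        using False L by (simp add: le_div_geq)
      finally show ?thesis .
    qed
  qed
  have "filterlim (\<lambda>n. n div L) at_top sequentially"
    unfolding filterlim_at_top
  proof
    fix Z
    show "\<forall>\<^sub>F n in sequentially. Z \<le> n div L"
      using eventually_ge_at_top[of "Z * L"]
      by eventually_elim (use L in \<open>simp add: less_eq_div_iff_mult_less_eq\<close>)
  qed
  moreover have "(\<lambda>n. \<theta> ^ n) \<longlonglongrightarrow> 0"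
    using \<theta> by (intro LIMSEQ_power_zero) simp
  ultimately have "(\<lambda>n. \<theta> ^ (n div L)) \<longlonglongrightarrow> 0"
    by (rule filterlim_compose[rotated])
  then have "(\<lambda>n. \<theta> ^ (n div L) * M) \<longlonglongrightarrow> 0"
    by (rule tendsto_mult_left_zero)
  then show ?thesis
    by (rule tendsto_sandwich[OF _ _ tendsto_const, rotated 2]) (use nn bound in auto)
qed

text \<open>Gaps of at least \<open>T\<close> make \<open>t\<close> unbounded, so every late time
  lies in some interval of large index.\<close>

lemma tendsto_zero_if_bounded_on_intervals:
  fixes f :: "real \<Rightarrow> real" and t V :: "nat \<Rightarrow> real"
  assumes t: "0 < T" "\<And>k. T \<le> t (Suc k) - t k" and V: "V \<longlonglongrightarrow> 0" and nn: "\<And>s. 0 \<le> f s"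
    and f: "\<And>k s. s \<in> {t k<..t (Suc k)} \<Longrightarrow> f s \<le> V k"
  shows "(f \<longlongrightarrow> 0) at_top"
proof (rule tendstoI)
  fix e :: real assume "0 < e"
  then have "\<forall>\<^sub>F k in sequentially. V k < e"
    using V by (rule order_tendstoD(2)[rotated])
  then obtain k0 where k0: "V k < e" if "k \<ge> k0" for k
    by (auto simp: eventually_sequentially)
  have grow: "t 0 + real n * T \<le> t n" for n
  proof (induction n)
    case (Suc n)
    then show ?case using t(2)[of n] by (simp add: algebra_simps)
  qed simp
  have "mono t"
    using t by (intro incseq_SucI) (smt (verit))
  have "dist (f x) 0 < e" if "x > t k0" for x
  proof -
    obtain n where "(x - t 0) / T \<le> real n"
      using real_arch_simple by blast
    then have "x \<le> t n"
      using t(1) grow[of n] by (simp add: field_simps)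
    \<comment> \<open>The least such index is the right end of the half-open interval containing
      \<open>x\<close>; it exceeds \<open>k0\<close> and hence is a successor.\<close>
    define j where "j = (LEAST n. x \<le> t n)"
    have j: "x \<le> t j"
      unfolding j_def by (rule LeastI) fact
    have less: "t i < x" if "i < j" for i
      using not_less_Least[of i "\<lambda>n. x \<le> t n"] that by (simp add: j_def)
    have "k0 < j"
      using j \<open>x > t k0\<close> monoD[OF \<open>mono t\<close>, of j k0] by (cases "j \<le> k0") auto
    then obtain k where k: "j = Suc k" "k0 \<le> k"
      by (cases j) auto
    then have "f x \<le> V k"
      using j less[of k] by (intro f) auto
    then show ?thesis
      using k0[OF k(2)] nn[of x] by simp
  qed
  then show "\<forall>\<^sub>F x in at_top. dist (f x) 0 < e"
    by (intro eventually_mono[OF eventually_gt_at_top[of "t k0"]])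
qed

section \<open>The jump-flow system as a perturbed consensus iteration\<close>

theorem theorem2:
  fixes d :: "'n::finite \<Rightarrow> real ^ 2"
    and C lam \<beta> :: "'n \<Rightarrow> real"
    and L :: nat
    and \<mu> T_min T_max \<sigma>_inf :: real
    and t :: "nat \<Rightarrow> real"
    and N :: "nat \<Rightarrow> 'n \<Rightarrow> 'n set"
    and \<xi> :: "nat \<Rightarrow> 'n \<Rightarrow> 'n \<Rightarrow> real"
    and H :: "nat \<Rightarrow> real ^ 'n ^ 'n"
    and \<sigma> :: "'n \<Rightarrow> nat \<Rightarrow> real"
    and p r :: "'n \<Rightarrow> real \<Rightarrow> real ^ 2"
    and p_plus r_plus s_plus :: "'n \<Rightarrow> nat \<Rightarrow> real ^ 2"
  assumes C_pos: "\<And>i. C i > 0"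
    and lam_pos: "\<And>i. lam i > 0"
    and L_pos: "L \<ge> 1"
    and mu_pos: "\<mu> > 0"
    and T_bounds: "0 < T_min" "T_min \<le> T_max"
    and t_nonneg: "\<And>k. t k \<ge> 0"
    and t_step: "\<And>k. T_min \<le> t (Suc k) - t k" "\<And>k. t (Suc k) - t k \<le> T_max"
    and self_neighbor: "\<And>k i. i \<in> N k i"
    and channel_coeff: "\<And>k i j. j \<in> N k i \<Longrightarrow> 0 < \<xi> k i j \<and> \<xi> k i j \<le> 1"
    and H_eq: "\<And>k. H k = normalized_channel_matrix (N k) (\<xi> k)"
    and ergodicity: "\<And>k. ergodicity_coeff (backward_prod H k L) \<le> 1 - \<mu>"
    and sigma_range: "\<And>i k. 0 < \<sigma> i k \<and> \<sigma> i k \<le> 1"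
    and sigma_inf_eq: "\<sigma>_inf = (INF (i, k)\<in>UNIV. \<sigma> i k)"
    and beta_eq: "\<And>i. \<beta> i = C i * exp (- lam i * T_min)"
    and r_jump: "\<And>i k. r_plus i k = d i + (\<Sum>j\<in>UNIV. H k $ i $ j *\<^sub>R (p j (t k) - d j))"
    and p_jump: "\<And>i k. p_plus i k = p i (t k)"
    and r_hold: "\<And>i k s. s \<in> {t k<..t (Suc k)} \<Longrightarrow> r i s = r_plus i k"
    and s_eq: "\<And>i k. s_plus i k = (1 - \<sigma> i k) *\<^sub>R p i (t k) + \<sigma> i k *\<^sub>R r_plus i k"
    and p_flow: "\<And>i k s. s \<in> {t k<..t (Suc k)} \<Longrightarrow>
      norm (p i s - s_plus i k) \<le> C i * exp (- lam i * (s - t k)) * norm (p i (t k) - s_plus i k)"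
    and small_gain: "\<And>i k. \<sigma> i k * \<beta> i < 1 / 2 * ((1 + \<sigma>_inf ^ L * \<mu>) powr (1 / real L) - 1)"
  shows "\<exists>c :: real \<Rightarrow> real ^ 2. \<forall>i. ((\<lambda>s. norm (p i s - c s - d i)) \<longlongrightarrow> 0) at_top"
proof -
  define g where "g = 1 / 2 * ((1 + \<sigma>_inf ^ L * \<mu>) powr (1 / real L) - 1)"
  define q where "q k i = p i (t k) - d i" for k i
  define a where "a k i = (1 - \<sigma> i k) *\<^sub>R q k i + \<sigma> i k *\<^sub>R average (H k) (q k) i" for k i
  have stoch: "row_stochastic (H k)" for k
    unfolding H_eq using self_neighbor channel_coeff
    by (intro row_stochastic_normalized_channel_matrix) blast+
  have beta_pos: "0 < \<beta> i" for i
    using C_pos by (simp add: beta_eq)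
  have inf_le: "\<sigma>_inf \<le> \<sigma> i k" for i k
  proof -
    have "bdd_below (range (\<lambda>(i, k). \<sigma> i k))"
      by (rule bdd_belowI2[of _ 0]) (use sigma_range less_imp_le in auto)
    then have "(INF (i, k)\<in>UNIV. \<sigma> i k) \<le> (case (i, k) of (i, k) \<Rightarrow> \<sigma> i k)"
      by (rule cINF_lower) simp
    then show ?thesis by (simp add: sigma_inf_eq)
  qed
  have "0 \<le> \<sigma>_inf"
    unfolding sigma_inf_eq by (rule cINF_greatest) (use sigma_range less_imp_le in auto)
  \<comment> \<open>If the infimum were 0, the small gain bound would be 0, but gains are
    positive.\<close>
  moreover have "\<sigma>_inf \<noteq> 0"
  proof
    assume "\<sigma>_inf = 0"
    then have "\<sigma> undefined 0 * \<beta> undefined < 0"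
      using small_gain[of undefined 0] L_pos by (simp add: power_0_left)
    then show False
      using sigma_range[of undefined 0] beta_pos[of undefined] by (simp add: mult_less_0_iff)
  qed
  ultimately have inf_pos: "0 < \<sigma>_inf" by simp
  have gain: "\<sigma> i k * \<beta> i < g" for i k
    unfolding g_def by (rule small_gain)
  \<comment> \<open>The bound \<open>g\<close> is chosen so that \<open>1 + 2 * g\<close> is the
    \<open>L\<close>-th root of \<open>1 + \<sigma>_inf ^ L * \<mu>\<close>.\<close>
  have power_g: "(1 + 2 * g) ^ L = 1 + \<sigma>_inf ^ L * \<mu>"
  proof -
    have pos: "0 < 1 + \<sigma>_inf ^ L * \<mu>"
      using inf_pos mu_pos by (simp add: add_pos_pos)
    have "(1 + 2 * g) ^ L = ((1 + \<sigma>_inf ^ L * \<mu>) powr (1 / real L)) ^ L"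
      by (simp add: g_def diff_divide_distrib)
    also have "\<dots> = (1 + \<sigma>_inf ^ L * \<mu>) powr (1 / real L * real L)"
      using pos by (simp add: powr_powr flip: powr_realpow)
    also have "\<dots> = 1 + \<sigma>_inf ^ L * \<mu>"
      using pos L_pos by simp
    finally show ?thesis .
  qed
  have s_plus: "s_plus i k = d i + a k i" for i k
    by (simp add: s_eq r_jump a_def q_def average_def algebra_simps)
  have disp: "p i (t k) - s_plus i k = \<sigma> i k *\<^sub>R (q k i - average (H k) (q k) i)" for i k
    by (simp add: s_plus a_def q_def algebra_simps)
  have t_less: "t k < t (Suc k)" for k
    using t_step(1)[of k] T_bounds(1) by linarith
  have step: "norm (q (Suc k) i - a k i) \<le> \<beta> i * (\<sigma> i k * norm (q k i - average (H k) (q k) i))" for i k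
  proof -
    have "norm (q (Suc k) i - a k i) = norm (p i (t (Suc k)) - s_plus i k)"
      by (simp add: q_def s_plus algebra_simps)
    also have "\<dots> \<le> C i * exp (- lam i * (t (Suc k) - t k)) * norm (p i (t k) - s_plus i k)"
      using t_less by (intro p_flow) simp
    also have "\<dots> \<le> \<beta> i * norm (p i (t k) - s_plus i k)"
      unfolding beta_eq using t_step(1)[of k] C_pos[of i] lam_pos[of i]
      by (intro mult_right_mono mult_left_mono) auto
    finally show ?thesis
      using sigma_range[of i k] by (simp add: disp)
  qed
  interpret perturbed_consensus H q \<sigma> \<beta> \<sigma>_inf g
    by unfold_locales
      (use stoch inf_pos inf_le sigma_range beta_pos gain step in \<open>auto simp: a_def less_imp_le\<close>)
  \<comment> \<open>Strictness survives the infimum over time, because the infimum lies below the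
    value at time index 0.\<close>
  have "\<sigma>_inf * \<beta> i < g" for i
  proof -
    have "\<sigma>_inf * \<beta> i \<le> \<sigma> i 0 * \<beta> i"
      by (intro mult_right_mono inf_le less_imp_le[OF beta_pos])
    then show ?thesis using gain[of i 0] by simp
  qed
  then obtain \<theta> where \<theta>: "0 \<le> \<theta>" "\<theta> < 1" "\<And>k. V (k + L) \<le> \<theta> * V k"
    using uniform_contraction[OF ergodicity L_pos inf_pos mu_pos] power_g by auto
  have V_lim: "V \<longlonglongrightarrow> 0"
    by (rule tendsto_zero_if_contracting[OF _ \<theta>(1,2) L_pos]) (rule V_nonneg, rule \<theta>(3))
  have a_K: "a k i \<in> K k" for i k
    unfolding a_def using sigma_range[of i k]
    by (intro convexD convex_convex_hull q_in_K average_in_K stoch) auto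
  \<comment> \<open>Between samples the exponential is bounded by 1 instead of decaying, so the
    distance to the averaged point is controlled by \<open>V k\<close>.\<close>
  have flow: "norm (p i x - d i - a k i) \<le> C i * V k" if x: "x \<in> {t k<..t (Suc k)}" for i k x
  proof -
    have "norm (p i x - d i - a k i) \<le> C i * exp (- lam i * (x - t k)) * norm (p i (t k) - s_plus i k)"
      using p_flow[OF x, of i] by (simp add: s_plus algebra_simps)
    also have "\<dots> \<le> C i * 1 * (1 * V k)"
      unfolding disp norm_scaleR
      using x C_pos[of i] lam_pos[of i] sigma_range[of i k] displacement_le[of k i] V_nonneg[of k]
      by (intro mult_mono) auto
    finally show ?thesis by simp
  qed
  \<comment> \<open>The centre follows an arbitrary agent \<open>i0\<close>; the pairwise
    differences alone decide the convergence.\<close>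
  define i0 where "i0 = (undefined :: 'n)"
  define c where "c x = p i0 x - d i0" for x
  have "((\<lambda>x. norm (p i x - c x - d i)) \<longlongrightarrow> 0) at_top" for i
  proof (rule tendsto_zero_if_bounded_on_intervals[where t = t, OF T_bounds(1) t_step(1)])
    show "(\<lambda>k. (C i + C i0 + 1) * V k) \<longlonglongrightarrow> 0"
      by (rule tendsto_mult_right_zero[OF V_lim])
    fix k x assume x: "x \<in> {t k<..t (Suc k)}"
    have "p i x - c x - d i = (p i x - d i - a k i) + (a k i - a k i0) - (p i0 x - d i0 - a k i0)"
      by (simp add: c_def)
    then have "norm (p i x - c x - d i) \<le> C i * V k + V k + C i0 * V k"
      using flow[OF x, of i] flow[OF x, of i0] hull_dist_le[OF a_K[of k i] a_K[of k i0]]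
      by (smt (verit) norm_triangle_ineq norm_triangle_ineq4)
    then show "norm (p i x - c x - d i) \<le> (C i + C i0 + 1) * V k"
      by (simp add: algebra_simps)
  qed simp
  then show ?thesis by blast
qed

end
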